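(* Let $n<p$, let $\mathbf X\in\mathbb R^{p\times n}$ be a fixed (non-random) matrix of full column rank $n$, and let $\mathbf A\in\mathbb R^{n\times K}$ be a fixed matrix of full column rank $K$ with columns $\mathbf a_1,\dots,\mathbf a_K$. Let $\mathbf M\in\mathbb R^{p\times K}$, let $\Sigma\in\mathbb R^{p\times p}$ be a covariance matrix, let $\boldsymbol\theta\in\mathbb R^K$ be nonzero, and let $\mathbf y$ be a random vector in $\mathbb R^p$ with $$\mathrm E[\mathbf y]=\mathbf M\boldsymbol\theta,\qquad \mathrm{Var}[\mathbf y]=\|\boldsymbol\theta\|_2^2\,\Sigma .$$ Put $\mathbf P_{\mathbf X}=\mathbf X(\mathbf X^\top\mathbf X)^{-1}\mathbf X^\top$, $$\hat{\boldsymbol\theta}_{\mathrm{RTS}}=\mathbf A^\top(\mathbf X^\top\mathbf X)^{-1}\mathbf X^\top\mathbf y,\qquad \mathrm{SSE}[\hat{\boldsymbol\theta}_{\mathrm{RTS}}]=\frac{\mathbf y^\top(\mathbf I_p-\mathbf P_{\mathbf X})\mathbf y}{p-n}\,\mathbf A^\top(\mathbf X^\top\mathbf X)^{-1}\mathbf A .$$ For $k\in\{1,\dots,K\}$ let $v_k$ be the $k$th diagonal entry of $\mathrm{Var}[\hat{\boldsymbol\theta}_{\mathrm{RTS}}]$ and $\hat v_k$ the $k$th diagonal entry of $\mathrm{SSE}[\hat{\boldsymbol\theta}_{\mathrm{RTS}}]$. Let $\mathbf E=\mathbf X\mathbf N$, where the columns of $\mathbf N\in\mathbb R^{n\times(n-K)}$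 form an orthonormal basis of the null space of $\mathbf A^\top$, and let - $\mathbf U_1$ be the $p\times(n-K)$ matrix whose columns are the left singular vectors of $\mathbf E$; - $\mathbf U_2$ be the $p\times K$ matrix whose columns are the left singular vectors of $\mathbf X(\mathbf X^\top\mathbf X)^{-1}\mathbf A$; - $\mathbf U_3$ be the $p\times(p-n)$ matrix whose columns are the left singular vectors of $\mathbf I_p-\mathbf P_{\mathbf X}$. Then for every $k\in\{1,\dots,K\}$, $$\frac{\mathrm E[v_k-\hat v_k]}{\|\boldsymbol\theta\|_2^2}\le \mathbf a_k^\top(\mathbf X^\top\mathbf X)^{-1}\mathbf a_k\left[\lambda_{\max}(\mathbf U_2^\top\Sigma\mathbf U_2)-\bar\lambda(\mathbf U_3^\top\Sigma\mathbf U_3)\right]$$ and $$\frac{\mathrm E[v_k-\hat v_k]}{\|\boldsymbol\theta\|_2^2}\ge \mathbf a_k^\top(\mathbf X^\top\mathbf X)^{-1}\mathbf a_k\left[\lambda_{\min}(\mathbf U_2^\top\Sigma\mathbf U_2)-\bar\lambda(\mathbf U_3^\top\Sigma\mathbf U_3)-\bar\lambda(\mathbf U_3^\top\mathbf M\mathbf M^\top\mathbf U_3)\right],$$ where $\lambda_{\min}$, $\lambda_{\max}$ and $\bar\lambda$ denote respectively the minimum, the maximum and the average eigenvalue.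
   Context: For a random vector, $\mathrm{Var}$ denotes its covariance matrix; a covariance matrix is a real symmetric positive semidefinite matrix. "The left singular vectors" of a matrix of rank $r$ means $r$ orthonormal left singular vectors corresponding to its nonzero singular values (so they form an orthonormal basis of its column space). The average eigenvalue $\bar\lambda(\mathbf B)$ of a symmetric $m\times m$ matrix $\mathbf B$ is $\mathrm{trace}(\mathbf B)/m$. *)

theory Defs
  imports
    "HOL-Probability.Probability"
    "Jordan_Normal_Form.Gauss_Jordan_Elimination"
    "Jordan_Normal_Form.DL_Rank"
    "Jordan_Normal_Form.Matrix_Kernel"
    "Jordan_Normal_Form.Spectral_Radius"
begin

no_notation inner (infix "\<bullet>" 70)
no_notation vec_nth (infixl "$" 90)

(* Vectors and matrices are those of Jordan_Normal_Form; indices start at 0. *)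
hide_const (open) Finite_Cartesian_Product.vec Finite_Cartesian_Product.mat
  Finite_Cartesian_Product.row Finite_Cartesian_Product.transpose

definition l2_norm :: "real vec \<Rightarrow> real" where
  "l2_norm v = sqrt (v \<bullet> v)"

(* vec_space.rank takes the length of the columns as its first argument. *)
definition full_column_rank :: "real mat \<Rightarrow> bool" where
  "full_column_rank B \<longleftrightarrow> vec_space.rank (dim_row B) B = dim_col B"

(* The value is unspecified if B is singular. *)
definition mat_inv :: "real mat \<Rightarrow> real mat" where
  "mat_inv B = the (mat_inverse B)"

definition orthonormal_cols :: "real mat \<Rightarrow> bool" where
  "orthonormal_cols B \<longleftrightarrow>
     (\<forall>i<dim_col B. \<forall>j<dim_col B. col B i \<bullet> col B j = (if i = j then 1 else 0))"

definition onb_null_space :: "real mat \<Rightarrow> real mat \<Rightarrow> bool" where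
  "onb_null_space N B \<longleftrightarrow> dim_row N = dim_col B \<and> orthonormal_cols N \<and>
     vec_space.col_space (dim_row N) N = mat_kernel B"

definition is_covariance_mat :: "nat \<Rightarrow> real mat \<Rightarrow> bool" where
  "is_covariance_mat d S \<longleftrightarrow> S \<in> carrier_mat d d \<and> S\<^sup>T = S \<and>
     (\<forall>x \<in> carrier_vec d. 0 \<le> x \<bullet> (S *\<^sub>v x))"

definition left_singular_vector :: "real mat \<Rightarrow> real \<Rightarrow> real vec \<Rightarrow> bool" where
  "left_singular_vector B s u \<longleftrightarrow>
     u \<in> carrier_vec (dim_row B) \<and> l2_norm u = 1 \<and> 0 \<le> s \<and>
     (\<exists>v \<in> carrier_vec (dim_col B). l2_norm v = 1 \<and>
        B *\<^sub>v v = s \<cdot>\<^sub>v u \<and> B\<^sup>T *\<^sub>v u = s \<cdot>\<^sub>v v)"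

definition left_singular_mat :: "real mat \<Rightarrow> real mat \<Rightarrow> bool" where
  "left_singular_mat B U \<longleftrightarrow>
     U \<in> carrier_mat (dim_row B) (vec_space.rank (dim_row B) B) \<and> orthonormal_cols U \<and>
     (\<forall>j<dim_col U. \<exists>s. s \<noteq> 0 \<and> left_singular_vector B s (col U j))"

definition lambda_max :: "real mat \<Rightarrow> real" where
  "lambda_max B = Max (spectrum B)"

definition lambda_min :: "real mat \<Rightarrow> real" where
  "lambda_min B = Min (spectrum B)"

definition mat_trace :: "real mat \<Rightarrow> real" where
  "mat_trace B = (\<Sum>i<dim_row B. B $$ (i, i))"

definition lambda_bar :: "real mat \<Rightarrow> real" where
  "lambda_bar B = mat_trace B / real (dim_row B)"

(* Finite second moments are what makes the mean vector and the covariance matrix below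
   exist; Bochner integrals of non-integrable functions are 0. *)
definition square_integrable_random_vector ::
    "'w measure \<Rightarrow> nat \<Rightarrow> ('w \<Rightarrow> real vec) \<Rightarrow> bool" where
  "square_integrable_random_vector \<Omega> d Y \<longleftrightarrow>
     (\<forall>\<omega> \<in> space \<Omega>. Y \<omega> \<in> carrier_vec d) \<and>
     (\<forall>i<d. (\<lambda>\<omega>. Y \<omega> $ i) \<in> borel_measurable \<Omega> \<and>
            integrable \<Omega> (\<lambda>\<omega>. (Y \<omega> $ i)\<^sup>2))"

definition mean_vec :: "'w measure \<Rightarrow> nat \<Rightarrow> ('w \<Rightarrow> real vec) \<Rightarrow> real vec" where
  "mean_vec \<Omega> d Y = vec d (\<lambda>i. prob_space.expectation \<Omega> (\<lambda>\<omega>. Y \<omega> $ i))"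

definition var_mat :: "'w measure \<Rightarrow> nat \<Rightarrow> ('w \<Rightarrow> real vec) \<Rightarrow> real mat" where
  "var_mat \<Omega> d Y = mat d d (\<lambda>(i, j). prob_space.expectation \<Omega>
     (\<lambda>\<omega>. (Y \<omega> $ i - mean_vec \<Omega> d Y $ i) * (Y \<omega> $ j - mean_vec \<Omega> d Y $ j)))"

definition proj_mat :: "real mat \<Rightarrow> real mat" where
  "proj_mat X = X * mat_inv (X\<^sup>T * X) * X\<^sup>T"

definition theta_RTS :: "real mat \<Rightarrow> real mat \<Rightarrow> real vec \<Rightarrow> real vec" where
  "theta_RTS X A y = (A\<^sup>T * mat_inv (X\<^sup>T * X) * X\<^sup>T) *\<^sub>v y"

definition SSE_RTS :: "real mat \<Rightarrow> real mat \<Rightarrow> real vec \<Rightarrow> real mat" where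
  "SSE_RTS X A y =
     (y \<bullet> ((1\<^sub>m (dim_row X) - proj_mat X) *\<^sub>v y) / (real (dim_row X) - real (dim_col X)))
       \<cdot>\<^sub>m (A\<^sup>T * mat_inv (X\<^sup>T * X) * A)"

end

(* Write C = (X^T X)^-1 and b_k = X C a_k, the k-th column of X C A. Then v_k = |theta|^2 b_k^T Sigma b_k
   and b_k^T b_k = a_k^T C a_k. As b_k lies in the range of U2, the two bounds on b_k^T Sigma b_k are
   Rayleigh bounds for U2^T Sigma U2. Since I - P_X = U3 U3^T, the expectation of
   y^T (I - P_X) y is |theta|^2 tr(U3^T Sigma U3) + |U3^T M theta|^2, and the last term is nonnegative
   and at most |theta|^2 tr(U3^T M M^T U3) by Cauchy-Schwarz. *)
theory Submission
  imports Defs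
begin

text \<open>The obstacle is to pass from \<open>left_singular_mat\<close>, which describes single
  columns, to the matrix identities U2 U2^T B = B, with B = X C A, and U3 U3^T = I - P_X. A column
  with nonzero singular value lies in the range of the matrix, so only a count of dimensions is
  missing. The prescribed widths K and p - n supply it: they make certain matrices square, and there
  a left inverse is also a right inverse. Division by p - n is what turns the traces into average
  eigenvalues. The mean of y contributes a nonnegative amount to the expectation of y^T (I - P_X) y,
  so it can only enlarge the expected variance estimate; this is why M enters the lower bound
  alone.\<close>

section \<open>Scalar products, full column rank and the inverse of the Gram matrix\<close>

lemma real_scalar_prod_self_eq_0:
  fixes v :: "real vec"
  assumes "v \<in> carrier_vec n" "v \<bullet> v = 0"
  shows "v = 0\<^sub>v n"
  using conjugate_square_eq_0_vec[of v n] assms by simp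

lemma real_scalar_prod_self_ge_0: "0 \<le> (v :: real vec) \<bullet> v"
  unfolding scalar_prod_def by (intro sum_nonneg) auto

text \<open>Independence and rank speak of the set of columns, in which repeated columns collapse. A
  repetition leaves fewer than \<open>nc\<close> elements, too few for an independent subset of size
  \<open>nc\<close>. Distinctness is a side condition of \<open>lin_depI\<close> and
  \<open>full_rank_lin_indpt\<close>.\<close>

lemma (in vec_space) full_rank_distinct:
  assumes A: "A \<in> carrier_mat n nc" and r: "rank A = nc"
  shows "distinct (cols A)"
proof (rule ccontr)
  assume nd: "\<not> distinct (cols A)"
  obtain S where S: "maximal S (\<lambda>T. T \<subseteq> set (cols A) \<and> lin_indpt T)"
    using maximal_exists[of "(\<lambda>T. T \<subseteq> set (cols A) \<and> lin_indpt T)" "card (set (cols A))" "{}"]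
    by (meson List.finite_set card_mono empty_iff empty_subsetI finite_lin_indpt2 rev_finite_subset)
  then have "card S \<le> card (set (cols A))" by (simp add: card_mono maximal_def)
  also have "\<dots> < length (cols A)"
    using nd card_distinct card_length le_neq_implies_less by blast
  finally show False using rank_card_indpt[OF A S] r A by simp
qed

lemma full_column_rank_kernel_trivial:
  assumes "full_column_rank X" "v \<in> carrier_vec (dim_col X)" "X *\<^sub>v v = 0\<^sub>v (dim_row X)"
  shows "v = 0\<^sub>v (dim_col X)"
proof (rule ccontr)
  interpret vec_space "TYPE(real)" "dim_row X" .
  assume nz: "v \<noteq> 0\<^sub>v (dim_col X)"
  have r: "rank X = dim_col X" using assms(1) by (simp add: full_column_rank_def)
  have X: "X \<in> carrier_mat (dim_row X) (dim_col X)" by simp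
  note d = full_rank_distinct[OF X r]
  show False
    using lin_depI[OF X assms(2) nz assms(3) d] full_rank_lin_indpt[OF X r d] by blast
qed

text \<open>A nonzero determinant makes \<open>A\<close> a unit of the matrix ring. This excludes
  the result \<open>None\<close> and gives the \<open>the\<close> in \<open>mat_inv\<close> its
  meaning.\<close>

lemma mat_inv_det_nonzero:
  assumes A: "A \<in> carrier_mat n n" and d: "det A \<noteq> 0"
  shows "mat_inv A \<in> carrier_mat n n" "A * mat_inv A = 1\<^sub>m n" "mat_inv A * A = 1\<^sub>m n"
proof -
  have "mat_inverse A \<noteq> None"
    using mat_inverse(1)[OF A, of "()"] det_non_zero_imp_unit[OF A d, of "()"] by auto
  then obtain B where "mat_inverse A = Some B" by auto
  with mat_inverse(2)[OF A this]
  show "mat_inv A \<in> carrier_mat n n" "A * mat_inv A = 1\<^sub>m n" "mat_inv A * A = 1\<^sub>m n"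
    by (auto simp: mat_inv_def)
qed

text \<open>A kernel vector v of X^T X satisfies |X v|^2 = (X^T X v) . v = 0, so v = 0 by full
  column rank; hence the determinant is nonzero.\<close>

lemma gram_inverse:
  assumes X: "X \<in> carrier_mat p n" and r: "full_column_rank X"
  defines "C \<equiv> mat_inv (X\<^sup>T * X)"
  shows "C \<in> carrier_mat n n" "C * (X\<^sup>T * X) = 1\<^sub>m n" "(X\<^sup>T * X) * C = 1\<^sub>m n" "C\<^sup>T = C"
proof -
  define G where "G = X\<^sup>T * X"
  have G: "G \<in> carrier_mat n n" and Gt: "G\<^sup>T = G"
    using X by (auto simp: G_def transpose_mult[of _ n p])
  have "det G \<noteq> 0"
  proof
    assume "det G = 0"
    then obtain v where v: "v \<in> carrier_vec n" "v \<noteq> 0\<^sub>v n" "G *\<^sub>v v = 0\<^sub>v n"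
      using det_0_iff_vec_prod_zero_field[OF G] by auto
    have "(X *\<^sub>v v) \<bullet> (X *\<^sub>v v) = (X\<^sup>T *\<^sub>v (X *\<^sub>v v)) \<bullet> v"
      using X v by (subst transpose_vec_mult_scalar[OF X]) auto
    also have "X\<^sup>T *\<^sub>v (X *\<^sub>v v) = G *\<^sub>v v"
      using X v by (simp add: G_def assoc_mult_mat_vec[of _ n p])
    finally have "(X *\<^sub>v v) \<bullet> (X *\<^sub>v v) = 0" using v by simp
    then have "X *\<^sub>v v = 0\<^sub>v p" using X v by (intro real_scalar_prod_self_eq_0[of _ p] mult_mat_vec_carrier[of _ p n])
    then show False using full_column_rank_kernel_trivial[OF r, of v] v X by auto
  qed
  note inv = mat_inv_det_nonzero[OF G this, folded C_def[folded G_def]]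
  show C: "C \<in> carrier_mat n n" and CG: "C * (X\<^sup>T * X) = 1\<^sub>m n" and GC: "(X\<^sup>T * X) * C = 1\<^sub>m n"
    using inv by (auto simp: G_def)
  \<comment> \<open>Inserting G C = I and regrouping with G^T = G lets the product be cancelled on
    the left instead.\<close>
  have "C\<^sup>T = C\<^sup>T * (G * C)" using C GC by (simp add: G_def)
  also have "\<dots> = (G * C)\<^sup>T * C"
    using C G Gt by (simp add: transpose_mult[of G n n C n] assoc_mult_mat[of _ n n _ n _ n])
  also have "\<dots> = C" using C GC by (simp add: G_def)
  finally show "C\<^sup>T = C" .
qed

section \<open>Rayleigh quotients and extremal eigenvalues of symmetric matrices\<close>

text \<open>The constant is crude, built from the sum of all absolute entries. Only its existence
  matters: it bounds the Rayleigh quotient above and quantifies coercivity.\<close>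

lemma quad_form_bound:
  fixes T :: "real mat"
  assumes T: "T \<in> carrier_mat n n"
  obtains c where "c > 0" "\<And>x. x \<in> carrier_vec n \<Longrightarrow> \<bar>x \<bullet> (T *\<^sub>v x)\<bar> \<le> c * (x \<bullet> x)"
proof
  let ?c = "(\<Sum>i<n. \<Sum>j<n. \<bar>T $$ (i,j)\<bar>)"
  have "?c \<ge> 0" by (intro sum_nonneg) auto
  \<comment> \<open>The added 1 keeps the constant positive even for T = 0;
    \<open>psd_invertible_coercive\<close> divides by it.\<close>
  then show "1 + ?c > 0" by simp
  fix x :: "real vec" assume x: "x \<in> carrier_vec n"
  have sq: "(x $ i)\<^sup>2 \<le> x \<bullet> x" if "i < n" for i
    using member_le_sum[of i "{0..<n}" "\<lambda>i. (x $ i)\<^sup>2"] that x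
    by (simp add: scalar_prod_def power2_eq_square)
  have "x \<bullet> (T *\<^sub>v x) = (\<Sum>i<n. \<Sum>j<n. x $ i * (T $$ (i,j) * x $ j))"
    using x T by (simp add: scalar_prod_def sum_distrib_left atLeast0LessThan)
  also have "\<bar>\<dots>\<bar> \<le> (\<Sum>i<n. \<Sum>j<n. \<bar>T $$ (i,j)\<bar> * (x \<bullet> x))"
  proof (intro order_trans[OF sum_abs] sum_mono)
    fix i j assume ij: "i \<in> {..<n}" "j \<in> {..<n}"
    have "2 * (\<bar>x $ i\<bar> * \<bar>x $ j\<bar>) \<le> (x $ i)\<^sup>2 + (x $ j)\<^sup>2"
      using sum_squares_bound[of "\<bar>x $ i\<bar>" "\<bar>x $ j\<bar>"] by simp
    also have "\<dots> \<le> 2 * (x \<bullet> x)" using sq[of i] sq[of j] ij by simp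
    finally have "\<bar>x $ i\<bar> * \<bar>x $ j\<bar> \<le> x \<bullet> x" by simp
    then have "\<bar>T $$ (i,j)\<bar> * (\<bar>x $ i\<bar> * \<bar>x $ j\<bar>) \<le> \<bar>T $$ (i,j)\<bar> * (x \<bullet> x)"
      by (rule mult_left_mono) simp
    then show "\<bar>x $ i * (T $$ (i,j) * x $ j)\<bar> \<le> \<bar>T $$ (i,j)\<bar> * (x \<bullet> x)"
      by (simp add: abs_mult mult_ac)
  qed
  also have "\<dots> = ?c * (x \<bullet> x)" by (simp add: sum_distrib_right)
  also have "\<dots> \<le> (1 + ?c) * (x \<bullet> x)"
    by (intro mult_right_mono real_scalar_prod_self_ge_0) simp
  finally show "\<bar>x \<bullet> (T *\<^sub>v x)\<bar> \<le> (1 + ?c) * (x \<bullet> x)" .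
qed

lemma symmetric_form_commute:
  fixes T :: "real mat"
  assumes "T \<in> carrier_mat n n" "T\<^sup>T = T" "x \<in> carrier_vec n" "y \<in> carrier_vec n"
  shows "x \<bullet> (T *\<^sub>v y) = (T *\<^sub>v x) \<bullet> y"
  using transpose_vec_mult_scalar[OF assms(1) assms(4) assms(3)] assms(2) by simp

text \<open>Two estimates are chained. Invertibility gives |x|^2 \<le> d |T x|^2, where d bounds the
  form of R^T R for the inverse R of T. Semidefiniteness gives |T x|^2 \<le> c (x . T x). Together
  they allow e = 1 / (c d).\<close>

lemma psd_invertible_coercive:
  fixes T :: "real mat"
  assumes T: "T \<in> carrier_mat n n" "T\<^sup>T = T"
    and psd: "\<And>x. x \<in> carrier_vec n \<Longrightarrow> 0 \<le> x \<bullet> (T *\<^sub>v x)"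
    and inv: "det T \<noteq> 0"
  obtains e where "e > 0" "\<And>x. x \<in> carrier_vec n \<Longrightarrow> e * (x \<bullet> x) \<le> x \<bullet> (T *\<^sub>v x)"
proof -
  define R where "R = mat_inv T"
  have R: "R \<in> carrier_mat n n" "R * T = 1\<^sub>m n"
    using mat_inv_det_nonzero[OF T(1) inv] by (auto simp: R_def)
  obtain c where c: "c > 0" "\<And>x. x \<in> carrier_vec n \<Longrightarrow> \<bar>x \<bullet> (T *\<^sub>v x)\<bar> \<le> c * (x \<bullet> x)"
    using quad_form_bound[OF T(1)] by blast
  obtain d where d: "d > 0" "\<And>x. x \<in> carrier_vec n \<Longrightarrow> \<bar>x \<bullet> ((R\<^sup>T * R) *\<^sub>v x)\<bar> \<le> d * (x \<bullet> x)"
    using quad_form_bound[of "R\<^sup>T * R" n] R(1) mult_carrier_mat[of "R\<^sup>T" n n R n]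
    by (metis transpose_carrier_mat)
  show ?thesis
  proof
    show "1 / (c * d) > 0" using c d by simp
    fix x :: "real vec" assume x: "x \<in> carrier_vec n"
    define z where "z = T *\<^sub>v x"
    have z: "z \<in> carrier_vec n" unfolding z_def by (rule mult_mat_vec_carrier[OF T(1) x])
    have Rz: "R *\<^sub>v z = x"
      using assoc_mult_mat_vec[OF R(1) T(1) x] R(2) x by (simp add: z_def)
    have "x \<bullet> x = z \<bullet> ((R\<^sup>T * R) *\<^sub>v z)"
      using transpose_vec_mult_scalar[of "R\<^sup>T" n n x z]
        assoc_mult_mat_vec[of "R\<^sup>T" n n R n z] R(1) z Rz x by simp
    with d(2)[OF z] have xz: "x \<bullet> x \<le> d * (z \<bullet> z)" by simp
    (* Positivity at x - z / c, the minimiser over s of the upper bound for the form at x - s z. *)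
    have w: "x - (1 / c) \<cdot>\<^sub>v z \<in> carrier_vec n" using x z by (intro minus_carrier_vec smult_carrier_vec[THEN iffD2])
    have xTz: "x \<bullet> (T *\<^sub>v z) = z \<bullet> z"
      using symmetric_form_commute[OF T x z] by (simp add: z_def)
    have zx: "z \<bullet> x = x \<bullet> z" by (rule comm_scalar_prod[OF z x])
    have Tz: "T *\<^sub>v z \<in> carrier_vec n" by (rule mult_mat_vec_carrier[OF T(1) z])
    have "0 \<le> (x - (1 / c) \<cdot>\<^sub>v z) \<bullet> (T *\<^sub>v (x - (1 / c) \<cdot>\<^sub>v z))" by (rule psd[OF w])
    also have "T *\<^sub>v (x - (1 / c) \<cdot>\<^sub>v z) = z - (1 / c) \<cdot>\<^sub>v (T *\<^sub>v z)"
      using mult_minus_distrib_mat_vec[OF T(1) x, of "(1 / c) \<cdot>\<^sub>v z"] mult_mat_vec[OF T(1) z, of "1 / c"] z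
      by (simp add: z_def[symmetric])
    also have "(x - (1 / c) \<cdot>\<^sub>v z) \<bullet> \<dots> = x \<bullet> z - 2 / c * (z \<bullet> z) + (z \<bullet> (T *\<^sub>v z)) / c\<^sup>2"
      using x z Tz xTz
      by (simp add: minus_scalar_prod_distrib[of _ n] scalar_prod_minus_distrib[of _ n]
          power2_eq_square)
    finally have "2 / c * (z \<bullet> z) - (z \<bullet> (T *\<^sub>v z)) / c\<^sup>2 \<le> x \<bullet> z" by simp
    moreover have "(z \<bullet> (T *\<^sub>v z)) / c\<^sup>2 \<le> (z \<bullet> z) / c"
      using c(1) c(2)[OF z] by (simp add: field_simps power2_eq_square)
    ultimately have "(z \<bullet> z) / c \<le> x \<bullet> z" by simp
    moreover have "1 / (c * d) * (x \<bullet> x) \<le> (z \<bullet> z) / c"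
      using xz c d by (simp add: field_simps)
    ultimately show "1 / (c * d) * (x \<bullet> x) \<le> x \<bullet> (T *\<^sub>v x)" by (simp add: z_def)
  qed
qed

text \<open>Compactness of the unit sphere is avoided: if \<open>s\<close> is the supremum of the Rayleigh quotient, then
  \<open>s I - S\<close> is positive semidefinite but not coercive, hence singular.\<close>

lemma symmetric_top_eigenvalue:
  fixes S :: "real mat"
  assumes S: "S \<in> carrier_mat n n" "S\<^sup>T = S" and n: "n > 0"
  obtains s where "eigenvalue S s" "\<And>x. x \<in> carrier_vec n \<Longrightarrow> x \<bullet> (S *\<^sub>v x) \<le> s * (x \<bullet> x)"
proof -
  define R where "R = {x \<bullet> (S *\<^sub>v x) | x. x \<in> carrier_vec n \<and> x \<bullet> x = 1}"
  define s where "s = Sup R"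
  obtain c where c: "\<And>x. x \<in> carrier_vec n \<Longrightarrow> \<bar>x \<bullet> (S *\<^sub>v x)\<bar> \<le> c * (x \<bullet> x)"
    using quad_form_bound[OF S(1)] by blast
  have "r \<le> c" if r: "r \<in> R" for r
  proof -
    obtain x where "r = x \<bullet> (S *\<^sub>v x)" "x \<in> carrier_vec n" "x \<bullet> x = 1"
      using r by (auto simp: R_def)
    then show ?thesis using c[of x] by simp
  qed
  then have bdd: "bdd_above R" by (rule bdd_aboveI)
  \<comment> \<open>Positive dimension provides a unit vector, so the supremum is taken over a
    nonempty set.\<close>
  have "unit_vec n 0 \<bullet> unit_vec n 0 = (1 :: real)" using n by simp
  then have ne: "R \<noteq> {}"
    using unit_vec_carrier[of n 0] by (force simp: R_def)
  have le: "x \<bullet> (S *\<^sub>v x) \<le> s * (x \<bullet> x)" if x: "x \<in> carrier_vec n" for x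
  proof (cases "x \<bullet> x = 0")
    case True
    then have "x = 0\<^sub>v n" using real_scalar_prod_self_eq_0[OF x] by simp
    then show ?thesis using S by simp
  next
    case False
    then have pos: "x \<bullet> x > 0" using real_scalar_prod_self_ge_0[of x] by linarith
    define t where "t = 1 / sqrt (x \<bullet> x)"
    have t: "t * t * (x \<bullet> x) = 1" using pos by (simp add: t_def)
    have Sx: "S *\<^sub>v x \<in> carrier_vec n" using S(1) x by (rule mult_mat_vec_carrier)
    have "(t \<cdot>\<^sub>v x) \<bullet> (S *\<^sub>v (t \<cdot>\<^sub>v x)) = t * t * (x \<bullet> (S *\<^sub>v x))"
      using Sx x by (simp add: mult_mat_vec[OF S(1) x] mult.assoc)
    moreover have "(t \<cdot>\<^sub>v x) \<bullet> (t \<cdot>\<^sub>v x) = 1" using t x by (simp add: mult.assoc)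
    moreover have "t \<cdot>\<^sub>v x \<in> carrier_vec n" using x by simp
    ultimately have "t * t * (x \<bullet> (S *\<^sub>v x)) \<in> R" unfolding R_def mem_Collect_eq by metis
    then have "t * t * (x \<bullet> (S *\<^sub>v x)) \<le> s" unfolding s_def using bdd by (rule cSup_upper)
    then have "t * t * (x \<bullet> (S *\<^sub>v x)) * (x \<bullet> x) \<le> s * (x \<bullet> x)"
      using pos by (intro mult_right_mono) auto
    moreover have "t * t * (x \<bullet> (S *\<^sub>v x)) * (x \<bullet> x) = x \<bullet> (S *\<^sub>v x)"
      using t by (simp add: mult_ac)
    ultimately show ?thesis by simp
  qed
  define T where "T = s \<cdot>\<^sub>m 1\<^sub>m n - S"
  have T: "T \<in> carrier_mat n n" unfolding T_def using S(1) by (rule minus_carrier_mat)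
  have Tt: "T\<^sup>T = T"
  proof (rule eq_matI)
    fix i j assume "i < dim_row T" "j < dim_col T"
    then have ij: "i < n" "j < n" using T by auto
    have "S $$ (j, i) = S $$ (i, j)" using ij S(1) arg_cong[OF S(2), of "\<lambda>m. m $$ (i, j)"] by simp
    then show "T\<^sup>T $$ (i, j) = T $$ (i, j)" using ij S(1) by (auto simp: T_def)
  qed (use T in auto)
  have Tv: "T *\<^sub>v x = s \<cdot>\<^sub>v x - S *\<^sub>v x" if x: "x \<in> carrier_vec n" for x
  proof -
    have I: "s \<cdot>\<^sub>m 1\<^sub>m n \<in> carrier_mat n n" by simp
    have "(s \<cdot>\<^sub>m 1\<^sub>m n) *\<^sub>v x = s \<cdot>\<^sub>v x" using x by (intro eq_vecI) auto
    then show ?thesis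
      unfolding T_def using minus_mult_distrib_mat_vec[OF I S(1) x] by simp
  qed
  have xT: "x \<bullet> (T *\<^sub>v x) = s * (x \<bullet> x) - x \<bullet> (S *\<^sub>v x)" if x: "x \<in> carrier_vec n" for x
  proof -
    have "S *\<^sub>v x \<in> carrier_vec n" using S(1) x by (rule mult_mat_vec_carrier)
    then show ?thesis using x by (simp add: Tv scalar_prod_minus_distrib[of _ n])
  qed
  have "det T = 0"
  proof (rule ccontr)
    assume d: "det T \<noteq> 0"
    have psd: "0 \<le> x \<bullet> (T *\<^sub>v x)" if "x \<in> carrier_vec n" for x
      using le[OF that] xT[OF that] by simp
    obtain e where e: "e > 0" "\<And>x. x \<in> carrier_vec n \<Longrightarrow> e * (x \<bullet> x) \<le> x \<bullet> (T *\<^sub>v x)"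
      using psd_invertible_coercive[OF T Tt psd d] by blast
    \<comment> \<open>Coercivity of s I - S keeps the form of S below s - e on the unit sphere,
      against the choice of s as least upper bound.\<close>
    have "r \<le> s - e" if r: "r \<in> R" for r
    proof -
      obtain x where "r = x \<bullet> (S *\<^sub>v x)" "x \<in> carrier_vec n" "x \<bullet> x = 1"
        using r by (auto simp: R_def)
      then show ?thesis using e(2)[of x] xT[of x] by simp
    qed
    then have "s \<le> s - e" unfolding s_def using ne by (intro cSup_least)
    then show False using e by simp
  qed
  then obtain v where v: "v \<in> carrier_vec n" "v \<noteq> 0\<^sub>v n" "T *\<^sub>v v = 0\<^sub>v n"
    using det_0_iff_vec_prod_zero_field[OF T] by auto
  have "S *\<^sub>v v = s \<cdot>\<^sub>v v"
  proof (rule eq_vecI)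
    fix i assume "i < dim_vec (s \<cdot>\<^sub>v v)"
    then have i: "i < n" using v by simp
    have "(s \<cdot>\<^sub>v v - S *\<^sub>v v) $ i = 0" unfolding Tv[OF v(1), symmetric] v(3) using i by simp
    then show "(S *\<^sub>v v) $ i = (s \<cdot>\<^sub>v v) $ i" using i v S by simp
  qed (use S v in auto)
  then have "eigenvalue S s"
    unfolding eigenvalue_def eigenvector_def using S v by auto
  then show ?thesis using that le by blast
qed

lemma rayleigh_le_lambda_max:
  fixes S :: "real mat"
  assumes S: "S \<in> carrier_mat n n" "S\<^sup>T = S" and x: "x \<in> carrier_vec n"
  shows "x \<bullet> (S *\<^sub>v x) \<le> lambda_max S * (x \<bullet> x)"
proof (cases "n = 0")
  \<comment> \<open>In dimension 0 the spectrum is empty and its \<open>Max\<close> unspecified, but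
    x . x = 0 makes both sides vanish.\<close>
  case True
  then show ?thesis using S x by (simp add: scalar_prod_def)
next
  case False
  then obtain s where s: "eigenvalue S s" "\<And>x. x \<in> carrier_vec n \<Longrightarrow> x \<bullet> (S *\<^sub>v x) \<le> s * (x \<bullet> x)"
    using symmetric_top_eigenvalue[OF S] by blast
  have "s \<le> lambda_max S"
    using s(1) card_finite_spectrum(1)[OF S(1)] by (simp add: lambda_max_def spectrum_def)
  then show ?thesis
    using s(2)[OF x] mult_right_mono[OF _ real_scalar_prod_self_ge_0[of x]] by force
qed

text \<open>Negation exchanges the two ends of the spectrum: a top eigenvalue s of -S yields the
  eigenvalue -s of S, which bounds the form of S from below.\<close>

lemma lambda_min_le_rayleigh:
  fixes S :: "real mat"
  assumes S: "S \<in> carrier_mat n n" "S\<^sup>T = S" and x: "x \<in> carrier_vec n"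
  shows "lambda_min S * (x \<bullet> x) \<le> x \<bullet> (S *\<^sub>v x)"
proof (cases "n = 0")
  case True
  then show ?thesis using S x by (simp add: scalar_prod_def)
next
  case False
  have S': "- S \<in> carrier_mat n n" "(- S)\<^sup>T = - S" using S by (auto simp: transpose_uminus)
  obtain s where s: "eigenvalue (- S) s"
    "\<And>x. x \<in> carrier_vec n \<Longrightarrow> x \<bullet> ((- S) *\<^sub>v x) \<le> s * (x \<bullet> x)"
    using symmetric_top_eigenvalue[OF S'] False by blast
  obtain v where v: "v \<in> carrier_vec n" "v \<noteq> 0\<^sub>v n" "(- S) *\<^sub>v v = s \<cdot>\<^sub>v v"
    using s(1) S by (auto simp: eigenvalue_def eigenvector_def)
  have "S *\<^sub>v v = - s \<cdot>\<^sub>v v"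
  proof (rule eq_vecI)
    fix i assume "i < dim_vec (- s \<cdot>\<^sub>v v)"
    then have i: "i < n" using v by simp
    have "- (S *\<^sub>v v) = s \<cdot>\<^sub>v v" using v S by simp
    then have "(- (S *\<^sub>v v)) $ i = (s \<cdot>\<^sub>v v) $ i" by simp
    then show "(S *\<^sub>v v) $ i = (- s \<cdot>\<^sub>v v) $ i" using i v(1) S(1) by simp
  qed (use S v in auto)
  then have "- s \<in> spectrum S"
    using S v by (auto simp: spectrum_def eigenvalue_def eigenvector_def)
  then have "lambda_min S \<le> - s"
    using card_finite_spectrum(1)[OF S(1)] by (simp add: lambda_min_def)
  then have "lambda_min S * (x \<bullet> x) \<le> - s * (x \<bullet> x)"
    by (rule mult_right_mono[OF _ real_scalar_prod_self_ge_0])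
  moreover have "x \<bullet> ((- S) *\<^sub>v x) = - (x \<bullet> (S *\<^sub>v x))" using S x by simp
  ultimately show ?thesis using s(2)[OF x] by simp
qed

section \<open>Traces and matrices of left singular vectors\<close>

lemma mat_trace_mult_commute:
  assumes "A \<in> carrier_mat n m" "B \<in> carrier_mat m n"
  shows "mat_trace (A * B) = mat_trace (B * A)"
proof -
  have "mat_trace (A * B) = (\<Sum>i<n. \<Sum>j<m. A $$ (i, j) * B $$ (j, i))"
    using assms by (simp add: mat_trace_def scalar_prod_def atLeast0LessThan)
  also have "\<dots> = (\<Sum>j<m. \<Sum>i<n. A $$ (i, j) * B $$ (j, i))" by (rule sum.swap)
  also have "\<dots> = mat_trace (B * A)"
    using assms by (simp add: mat_trace_def scalar_prod_def atLeast0LessThan mult.commute)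
  finally show ?thesis .
qed

lemma orthonormal_cols_gram:
  assumes "U \<in> carrier_mat p r" "orthonormal_cols U"
  shows "U\<^sup>T * U = 1\<^sub>m r"
proof (rule eq_matI)
  fix i j assume "i < dim_row (1\<^sub>m r)" "j < dim_col (1\<^sub>m r)"
  then have ij: "i < r" "j < r" by auto
  then have "col U i \<bullet> col U j = (if i = j then 1 else 0)"
    using assms by (simp add: orthonormal_cols_def)
  then show "(U\<^sup>T * U) $$ (i, j) = 1\<^sub>m r $$ (i, j)" using ij assms(1) by simp
qed (use assms(1) in auto)

text \<open>A left singular vector u with s \<noteq> 0 and right partner v equals B (v / s), hence
  lies in the range of B. The columns of W are these preimages.\<close>

lemma left_singular_mat_factor:
  assumes B: "B \<in> carrier_mat p m" and U: "U \<in> carrier_mat p r" and l: "left_singular_mat B U"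
  obtains W where "W \<in> carrier_mat m r" "U = B * W"
proof -
  have "\<exists>w \<in> carrier_vec m. B *\<^sub>v w = col U j" if j: "j < r" for j
  proof -
    obtain s v where s: "s \<noteq> 0" "v \<in> carrier_vec m" "B *\<^sub>v v = s \<cdot>\<^sub>v col U j"
      using l j carrier_matD(2)[OF U] carrier_matD(2)[OF B]
      unfolding left_singular_mat_def left_singular_vector_def by metis
    have "B *\<^sub>v ((1 / s) \<cdot>\<^sub>v v) = col U j"
      using s by (simp add: mult_mat_vec[OF B] smult_smult_assoc)
    then show ?thesis using s by (intro bexI[of _ "(1 / s) \<cdot>\<^sub>v v"]) auto
  qed
  then obtain w where w: "\<And>j. j < r \<Longrightarrow> w j \<in> carrier_vec m" "\<And>j. j < r \<Longrightarrow> B *\<^sub>v w j = col U j"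
    by metis
  define W where "W = mat m r (\<lambda>(i, j). w j $ i)"
  have W: "W \<in> carrier_mat m r" by (simp add: W_def)
  have cW: "col W j = w j" if "j < r" for j
    using that w(1)[OF that] by (intro eq_vecI) (auto simp: W_def)
  have "U = B * W"
  proof (rule mat_col_eqI)
    fix i assume "i < dim_col (B * W)"
    then have i: "i < r" using W by simp
    show "col U i = col (B * W) i" using w(2)[OF i] col_mult2[OF B W i] cW[OF i] by simp
  qed (use U B W in auto)
  then show ?thesis using W that by blast
qed

lemma left_singular_mat_absorb:
  assumes B: "B \<in> carrier_mat p k" and U: "U \<in> carrier_mat p k" and l: "left_singular_mat B U"
  shows "U * (U\<^sup>T * B) = B"
proof -
  (* U = B W with square W, so U^T B W = I makes W the two-sided inverse of U^T B. *)
  obtain W where W: "W \<in> carrier_mat k k" and UW: "U = B * W"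
    using left_singular_mat_factor[OF B U l] by blast
  have UB: "U\<^sup>T * B \<in> carrier_mat k k" using U B by simp
  have "(U\<^sup>T * B) * W = U\<^sup>T * U"
    using U B W by (simp add: UW assoc_mult_mat[of _ k p _ k _ k])
  also have "\<dots> = 1\<^sub>m k"
    using orthonormal_cols_gram[OF U] l by (simp add: left_singular_mat_def)
  finally have "W * (U\<^sup>T * B) = 1\<^sub>m k" by (rule mat_mult_left_right_inverse[OF UB W])
  then have "B * (W * (U\<^sup>T * B)) = B" using B by simp
  then show ?thesis
    using assoc_mult_mat[OF B W UB] UW by simp
qed

text \<open>The columns of U lie in the range of Q = I - P_X, and Q X = 0 with Q symmetric makes
  them orthogonal to those of X. Being p - n orthonormal vectors, they fill the orthogonal
  complement of the range of X, so U U^T is the projection onto it.\<close>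

lemma left_singular_mat_complement:
  assumes X: "X \<in> carrier_mat p n" and rk: "full_column_rank X" and np: "n \<le> p"
    and U: "U \<in> carrier_mat p (p - n)" and l: "left_singular_mat (1\<^sub>m p - proj_mat X) U"
  shows "U * U\<^sup>T = 1\<^sub>m p - proj_mat X"
proof -
  define C where "C = mat_inv (X\<^sup>T * X)"
  note C = gram_inverse[OF X rk, folded C_def]
  have P: "proj_mat X = X * (C * X\<^sup>T)"
    using X C(1) by (simp add: proj_mat_def C_def[symmetric] assoc_mult_mat[of X p n C n "X\<^sup>T" p])
  define Q where "Q = 1\<^sub>m p - proj_mat X"
  have CX: "C * X\<^sup>T \<in> carrier_mat n p" using C(1) X by simp
  have Pc: "proj_mat X \<in> carrier_mat p p" using P X CX by simp
  have Q: "Q \<in> carrier_mat p p" using Pc by (simp add: Q_def minus_carrier_mat)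
  have "(proj_mat X)\<^sup>T = (C * X\<^sup>T)\<^sup>T * X\<^sup>T"
    unfolding P using X CX by (rule transpose_mult)
  also have "(C * X\<^sup>T)\<^sup>T = X * C"
    using transpose_mult[of C n n "X\<^sup>T" p] C X by simp
  also have "X * C * X\<^sup>T = proj_mat X"
    using X C(1) by (simp add: proj_mat_def C_def[symmetric])
  finally have "(proj_mat X)\<^sup>T = proj_mat X" .
  then have Qt: "Q\<^sup>T = Q" using transpose_minus[OF one_carrier_mat Pc] by (simp add: Q_def)
  have CXX: "(C * X\<^sup>T) * X = 1\<^sub>m n"
    using assoc_mult_mat[of C n n "X\<^sup>T" p X n] X C by simp
  have PX: "proj_mat X * X = X"
    unfolding P using assoc_mult_mat[OF X CX X] CXX X by simp
  have QX: "Q * X = 0\<^sub>m p n"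
    unfolding Q_def using minus_mult_distrib_mat[of "1\<^sub>m p" p p "proj_mat X" X n] Pc PX X by simp
  obtain W where W: "W \<in> carrier_mat p (p - n)" and UW: "U = Q * W"
    using left_singular_mat_factor[OF Q U] l by (auto simp: Q_def)
  have "U\<^sup>T * X = W\<^sup>T * (Q * X)"
    using transpose_mult[OF Q W] Qt UW assoc_mult_mat[of "W\<^sup>T" "p - n" p Q p X n] W Q X by simp
  then have UX: "U\<^sup>T * X = 0\<^sub>m (p - n) n" using QX W by simp
  have "X\<^sup>T * U = (U\<^sup>T * X)\<^sup>T"
    using transpose_mult[of "U\<^sup>T" "p - n" p X n] U X by simp
  then have XU: "X\<^sup>T * U = 0\<^sub>m n (p - n)" using UX by (simp add: zero_transpose_mat)
  have CXU: "(C * X\<^sup>T) * U = 0\<^sub>m n (p - n)"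
    using assoc_mult_mat[of C n n "X\<^sup>T" p U "p - n"] C(1) X U XU by simp
  have UU: "U\<^sup>T * U = 1\<^sub>m (p - n)"
    using orthonormal_cols_gram[OF U] l by (simp add: left_singular_mat_def)
  (* L is a left inverse, hence also a right inverse, of the square matrix Z = [X | U];
     Z L = I is the claim. The empty blocks only serve to use four_block_mat for concatenation. *)
  define L where "L = four_block_mat (C * X\<^sup>T) (0\<^sub>m n 0) U\<^sup>T (0\<^sub>m (p - n) 0)"
  define Z where "Z = four_block_mat X U (0\<^sub>m 0 n) (0\<^sub>m 0 (p - n))"
  have pn: "n + (p - n) = p" using np by simp
  have L: "L \<in> carrier_mat p p"
    using four_block_carrier_mat[OF CX zero_carrier_mat[of "p - n" 0], of "0\<^sub>m n 0" "U\<^sup>T"] pn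
    by (simp add: L_def)
  have Z: "Z \<in> carrier_mat p p"
    using four_block_carrier_mat[OF X zero_carrier_mat[of 0 "p - n"], of U "0\<^sub>m 0 n"] pn
    by (simp add: Z_def)
  have Ut: "U\<^sup>T \<in> carrier_mat (p - n) p" using U by simp
  have "L * Z = four_block_mat (1\<^sub>m n) (0\<^sub>m n (p - n)) (0\<^sub>m (p - n) n) (1\<^sub>m (p - n))"
    unfolding L_def Z_def
    by (subst mult_four_block_mat[OF CX zero_carrier_mat Ut zero_carrier_mat X U zero_carrier_mat
          zero_carrier_mat]) (simp add: CXX CXU UX UU)
  also have "\<dots> = 1\<^sub>m p" using pn by simp
  finally have ZL: "Z * L = 1\<^sub>m p" by (rule mat_mult_left_right_inverse[OF L Z])
  have UUc: "U * U\<^sup>T \<in> carrier_mat p p" using U by simp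
  \<comment> \<open>Only the upper left block has entries, so the identity can be read off entry by
    entry.\<close>
  have blk: "Z * L = four_block_mat (proj_mat X + U * U\<^sup>T) (0\<^sub>m p 0) (0\<^sub>m 0 p) (0\<^sub>m 0 0)"
    unfolding L_def Z_def
    by (subst mult_four_block_mat[OF X U zero_carrier_mat zero_carrier_mat CX zero_carrier_mat
          Ut zero_carrier_mat]) (use X U CX Ut left_mult_zero_mat[OF CX, of 0] in \<open>simp add: P\<close>)
  have sum1: "proj_mat X $$ (i, j) + (U * U\<^sup>T) $$ (i, j) = 1\<^sub>m p $$ (i, j)"
    if ij: "i < p" "j < p" for i j
  proof -
    have "(Z * L) $$ (i, j) = (proj_mat X + U * U\<^sup>T) $$ (i, j)"
      unfolding blk using ij Pc UUc by (subst index_mat_four_block(1)) auto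
    also have "\<dots> = proj_mat X $$ (i, j) + (U * U\<^sup>T) $$ (i, j)"
      using ij UUc by (intro index_add_mat(1)) auto
    finally show ?thesis unfolding ZL by simp
  qed
  show ?thesis
  proof (rule eq_matI)
    fix i j assume "i < dim_row (1\<^sub>m p - proj_mat X)" "j < dim_col (1\<^sub>m p - proj_mat X)"
    then have ij: "i < p" "j < p" using Pc by auto
    have "(1\<^sub>m p - proj_mat X) $$ (i, j) = 1\<^sub>m p $$ (i, j) - proj_mat X $$ (i, j)"
      using ij Pc by (intro index_minus_mat(1)) auto
    then show "(U * U\<^sup>T) $$ (i, j) = (1\<^sub>m p - proj_mat X) $$ (i, j)" using sum1[OF ij] by simp
  qed (use Pc UUc in auto)
qed

section \<open>Moments of square integrable random vectors\<close>

context prob_space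
begin

text \<open>The product is dominated by the integrable function f^2 + g^2, since 2 |f g| \<le> f^2 +
  g^2.\<close>

lemma integrable_mult_of_square:
  fixes f g :: "'a \<Rightarrow> real"
  assumes [measurable]: "f \<in> borel_measurable M" "g \<in> borel_measurable M"
    and "integrable M (\<lambda>x. (f x)\<^sup>2)" "integrable M (\<lambda>x. (g x)\<^sup>2)"
  shows "integrable M (\<lambda>x. f x * g x)"
proof (rule Bochner_Integration.integrable_bound)
  show "integrable M (\<lambda>x. (f x)\<^sup>2 + (g x)\<^sup>2)" using assms by simp
  have "\<bar>f x * g x\<bar> \<le> (f x)\<^sup>2 + (g x)\<^sup>2" for x
  proof -
    have "2 * (\<bar>f x\<bar> * \<bar>g x\<bar>) \<le> (f x)\<^sup>2 + (g x)\<^sup>2"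
      using sum_squares_bound[of "\<bar>f x\<bar>" "\<bar>g x\<bar>"] by simp
    moreover have "0 \<le> \<bar>f x\<bar> * \<bar>g x\<bar>" by simp
    ultimately show ?thesis unfolding abs_mult by linarith
  qed
  then show "AE x in M. norm (f x * g x) \<le> norm ((f x)\<^sup>2 + (g x)\<^sup>2)" by simp
qed simp

context
  fixes d :: nat and Y :: "'a \<Rightarrow> real vec"
  assumes Y: "square_integrable_random_vector M d Y"
begin

lemma Y_dim: "\<omega> \<in> space M \<Longrightarrow> Y \<omega> \<in> carrier_vec d"
  using Y by (simp add: square_integrable_random_vector_def)

lemma integrable_component: "i < d \<Longrightarrow> integrable M (\<lambda>\<omega>. Y \<omega> $ i)"
  using Y by (auto simp: square_integrable_random_vector_def intro: square_integrable_imp_integrable)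

lemma integrable_component_mult:
  "i < d \<Longrightarrow> j < d \<Longrightarrow> integrable M (\<lambda>\<omega>. Y \<omega> $ i * Y \<omega> $ j)"
  using Y by (auto simp: square_integrable_random_vector_def intro: integrable_mult_of_square)

lemma var_mat_entry:
  assumes ij: "i < d" "j < d"
  shows "var_mat M d Y $$ (i, j)
    = expectation (\<lambda>\<omega>. Y \<omega> $ i * Y \<omega> $ j) - mean_vec M d Y $ i * mean_vec M d Y $ j"
proof -
  have m: "mean_vec M d Y $ i = expectation (\<lambda>\<omega>. Y \<omega> $ i)" if "i < d" for i
    using that by (simp add: mean_vec_def)
  let ?m = "mean_vec M d Y"
  have "(\<lambda>\<omega>. (Y \<omega> $ i - ?m $ i) * (Y \<omega> $ j - ?m $ j))
    = (\<lambda>\<omega>. Y \<omega> $ i * Y \<omega> $ j - ?m $ j * Y \<omega> $ i - ?m $ i * Y \<omega> $ j + ?m $ i * ?m $ j)"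
    by (simp add: algebra_simps)
  then show ?thesis
    using ij integrable_component integrable_component_mult
    by (simp add: var_mat_def m prob_space)
qed

text \<open>Expand the form in entries and insert E[Y_i Y_j] = V_ij + m_i m_j. Integrability is what
  later allows the expectation of a difference to be split.\<close>

lemma expectation_quad_form:
  assumes Q: "Q \<in> carrier_mat d d"
  shows "integrable M (\<lambda>\<omega>. Y \<omega> \<bullet> (Q *\<^sub>v Y \<omega>))"
    and "expectation (\<lambda>\<omega>. Y \<omega> \<bullet> (Q *\<^sub>v Y \<omega>))
      = mat_trace (Q * var_mat M d Y) + mean_vec M d Y \<bullet> (Q *\<^sub>v mean_vec M d Y)"
proof -
  let ?m = "mean_vec M d Y" and ?V = "var_mat M d Y"
  have form: "x \<bullet> (Q *\<^sub>v x) = (\<Sum>i<d. \<Sum>j<d. Q $$ (i, j) * (x $ i * x $ j))"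
    if "x \<in> carrier_vec d" for x
    using that Q by (simp add: scalar_prod_def sum_distrib_left atLeast0LessThan mult_ac)
  have eq: "\<omega> \<in> space M \<Longrightarrow>
      Y \<omega> \<bullet> (Q *\<^sub>v Y \<omega>) = (\<Sum>i<d. \<Sum>j<d. Q $$ (i, j) * (Y \<omega> $ i * Y \<omega> $ j))" for \<omega>
    by (rule form[OF Y_dim])
  have int: "integrable M (\<lambda>\<omega>. \<Sum>i<d. \<Sum>j<d. Q $$ (i, j) * (Y \<omega> $ i * Y \<omega> $ j))"
    by (intro Bochner_Integration.integrable_sum integrable_mult_right integrable_component_mult) auto
  show "integrable M (\<lambda>\<omega>. Y \<omega> \<bullet> (Q *\<^sub>v Y \<omega>))"
    using int by (subst Bochner_Integration.integrable_cong[OF refl eq]) auto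
  have m: "?m \<in> carrier_vec d" by (simp add: mean_vec_def)
  have V: "?V \<in> carrier_mat d d" by (simp add: var_mat_def)
  \<comment> \<open>The trace of \<open>Q * ?V\<close> pairs Q_ij with V_ji, whereas the expansion
    produces V_ij.\<close>
  have Vs: "?V $$ (i, j) = ?V $$ (j, i)" if "i < d" "j < d" for i j
    using that by (simp add: var_mat_entry mult.commute)
  have "expectation (\<lambda>\<omega>. Y \<omega> \<bullet> (Q *\<^sub>v Y \<omega>))
      = expectation (\<lambda>\<omega>. \<Sum>i<d. \<Sum>j<d. Q $$ (i, j) * (Y \<omega> $ i * Y \<omega> $ j))"
    by (rule Bochner_Integration.integral_cong[OF refl eq])
  also have "\<dots> = (\<Sum>i<d. \<Sum>j<d. Q $$ (i, j) * expectation (\<lambda>\<omega>. Y \<omega> $ i * Y \<omega> $ j))"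
    by (subst Bochner_Integration.integral_sum)
      (auto intro!: sum.cong Bochner_Integration.integrable_sum integrable_component_mult
        simp: Bochner_Integration.integral_sum integrable_component_mult)
  also have "\<dots> = (\<Sum>i<d. \<Sum>j<d. Q $$ (i, j) * ?V $$ (j, i))
      + (\<Sum>i<d. \<Sum>j<d. Q $$ (i, j) * (?m $ i * ?m $ j))"
    unfolding sum.distrib[symmetric]
    by (intro sum.cong) (auto simp: Vs[of j i for i j] var_mat_entry algebra_simps)
  also have "(\<Sum>i<d. \<Sum>j<d. Q $$ (i, j) * ?V $$ (j, i)) = mat_trace (Q * ?V)"
    using Q V by (simp add: mat_trace_def scalar_prod_def atLeast0LessThan)
  also have "(\<Sum>i<d. \<Sum>j<d. Q $$ (i, j) * (?m $ i * ?m $ j)) = ?m \<bullet> (Q *\<^sub>v ?m)"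
    by (rule form[OF m, symmetric])
  finally show "expectation (\<lambda>\<omega>. Y \<omega> \<bullet> (Q *\<^sub>v Y \<omega>))
      = mat_trace (Q * ?V) + ?m \<bullet> (Q *\<^sub>v ?m)" .
qed

text \<open>Centering commutes with linear maps, so the squared centered component is a double sum
  of products of centered components of Y, whose expectations are covariances.\<close>

lemma var_mat_linear_diag:
  assumes L: "L \<in> carrier_mat K d" and k: "k < K"
  shows "var_mat M K (\<lambda>\<omega>. L *\<^sub>v Y \<omega>) $$ (k, k) = row L k \<bullet> (var_mat M d Y *\<^sub>v row L k)"
proof -
  let ?r = "\<lambda>i. L $$ (k, i)" and ?m = "mean_vec M d Y" and ?V = "var_mat M d Y"
  \<comment> \<open>The length of \<open>Y \<omega>\<close>, and with it the range of the sum, is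
    known only on the sample space; this suffices under the integral.\<close>
  have comp: "(L *\<^sub>v Y \<omega>) $ k = (\<Sum>i<d. ?r i * Y \<omega> $ i)" if "\<omega> \<in> space M" for \<omega>
    using L k Y_dim[OF that] by (simp add: scalar_prod_def atLeast0LessThan)
  have "mean_vec M K (\<lambda>\<omega>. L *\<^sub>v Y \<omega>) $ k = expectation (\<lambda>\<omega>. (L *\<^sub>v Y \<omega>) $ k)"
    using k by (simp add: mean_vec_def)
  also have "\<dots> = expectation (\<lambda>\<omega>. \<Sum>i<d. ?r i * Y \<omega> $ i)"
    by (rule Bochner_Integration.integral_cong[OF refl comp])
  also have "\<dots> = (\<Sum>i<d. ?r i * ?m $ i)"
    by (subst Bochner_Integration.integral_sum)
      (auto intro!: sum.cong integrable_component simp: mean_vec_def)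
  finally have mean: "mean_vec M K (\<lambda>\<omega>. L *\<^sub>v Y \<omega>) $ k = (\<Sum>i<d. ?r i * ?m $ i)" .
  have int: "integrable M (\<lambda>\<omega>. (Y \<omega> $ i - ?m $ i) * (Y \<omega> $ j - ?m $ j))"
    if "i < d" "j < d" for i j
    using that integrable_component integrable_component_mult
    by (simp add: algebra_simps)
  have "var_mat M K (\<lambda>\<omega>. L *\<^sub>v Y \<omega>) $$ (k, k)
      = expectation (\<lambda>\<omega>. ((L *\<^sub>v Y \<omega>) $ k - (\<Sum>i<d. ?r i * ?m $ i))
          * ((L *\<^sub>v Y \<omega>) $ k - (\<Sum>i<d. ?r i * ?m $ i)))"
    using k by (simp add: var_mat_def mean)
  also have "\<dots> = expectation (\<lambda>\<omega>. \<Sum>i<d. \<Sum>j<d.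
      ?r i * ?r j * ((Y \<omega> $ i - ?m $ i) * (Y \<omega> $ j - ?m $ j)))"
  proof (rule Bochner_Integration.integral_cong[OF refl])
    fix \<omega> assume w: "\<omega> \<in> space M"
    have "(L *\<^sub>v Y \<omega>) $ k - (\<Sum>i<d. ?r i * ?m $ i) = (\<Sum>i<d. ?r i * (Y \<omega> $ i - ?m $ i))"
      by (simp only: comp[OF w] right_diff_distrib sum_subtractf)
    then show "((L *\<^sub>v Y \<omega>) $ k - (\<Sum>i<d. ?r i * ?m $ i))
        * ((L *\<^sub>v Y \<omega>) $ k - (\<Sum>i<d. ?r i * ?m $ i))
      = (\<Sum>i<d. \<Sum>j<d. ?r i * ?r j * ((Y \<omega> $ i - ?m $ i) * (Y \<omega> $ j - ?m $ j)))"
      by (simp only: sum_product mult_ac)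
  qed
  also have "\<dots> = (\<Sum>i<d. \<Sum>j<d. ?r i * ?r j * ?V $$ (i, j))"
    by (subst Bochner_Integration.integral_sum)
      (auto intro!: sum.cong Bochner_Integration.integrable_sum int
        simp: Bochner_Integration.integral_sum int var_mat_def)
  also have "\<dots> = row L k \<bullet> (?V *\<^sub>v row L k)"
    using L k by (simp add: scalar_prod_def sum_distrib_left atLeast0LessThan mult_ac var_mat_def)
  finally show ?thesis .
qed

end

end

section \<open>Frobenius bound and compression of quadratic forms\<close>

lemma l2_norm_square: "(l2_norm v)\<^sup>2 = v \<bullet> v"
  by (simp add: l2_norm_def real_scalar_prod_self_ge_0)

text \<open>The trace of W W^T is the squared Frobenius norm, the sum of all squared entries.
  Cauchy-Schwarz is applied to each row and summed.\<close>

lemma mult_mat_vec_frobenius_bound: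
  fixes W :: "real mat"
  assumes W: "W \<in> carrier_mat r k" and x: "x \<in> carrier_vec k"
  shows "(W *\<^sub>v x) \<bullet> (W *\<^sub>v x) \<le> mat_trace (W * W\<^sup>T) * (x \<bullet> x)"
proof -
  have "(W *\<^sub>v x) \<bullet> (W *\<^sub>v x) = (\<Sum>i<r. (\<Sum>j<k. W $$ (i, j) * x $ j)\<^sup>2)"
    using W x by (simp add: scalar_prod_def atLeast0LessThan power2_eq_square)
  also have "\<dots> \<le> (\<Sum>i<r. (\<Sum>j<k. (W $$ (i, j))\<^sup>2) * (\<Sum>j<k. (x $ j)\<^sup>2))"
    by (intro sum_mono Cauchy_Schwarz_ineq_sum)
  also have "\<dots> = mat_trace (W * W\<^sup>T) * (x \<bullet> x)"
    using W x by (simp add: mat_trace_def scalar_prod_def atLeast0LessThan power2_eq_square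
        sum_distrib_right)
  finally show ?thesis .
qed

text \<open>Transfers the form at a vector of the range of U to the compressed matrix, whose
  eigenvalues occur in the bounds.\<close>

lemma transpose_mult_quad_form:
  fixes U S :: "real mat"
  assumes U: "U \<in> carrier_mat p k" and S: "S \<in> carrier_mat p p" and w: "w \<in> carrier_vec k"
  shows "(U *\<^sub>v w) \<bullet> (S *\<^sub>v (U *\<^sub>v w)) = w \<bullet> ((U\<^sup>T * S * U) *\<^sub>v w)"
proof -
  have Uw: "U *\<^sub>v w \<in> carrier_vec p" using U w by (rule mult_mat_vec_carrier)
  then have SUw: "S *\<^sub>v (U *\<^sub>v w) \<in> carrier_vec p" by (rule mult_mat_vec_carrier[OF S])
  have US: "U\<^sup>T * S \<in> carrier_mat k p" using U S by simp
  have "(U\<^sup>T * S * U) *\<^sub>v w = U\<^sup>T *\<^sub>v (S *\<^sub>v (U *\<^sub>v w))"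
    using assoc_mult_mat_vec[OF US U w] assoc_mult_mat_vec[of "U\<^sup>T" k p S p "U *\<^sub>v w"] U S Uw
    by simp
  moreover have "w \<bullet> (U\<^sup>T *\<^sub>v (S *\<^sub>v (U *\<^sub>v w))) = (U *\<^sub>v w) \<bullet> (S *\<^sub>v (U *\<^sub>v w))"
    using transpose_vec_mult_scalar[of "U\<^sup>T" k p "S *\<^sub>v (U *\<^sub>v w)" w] U SUw w by simp
  ultimately show ?thesis by simp
qed

lemma transpose_mult_symmetric:
  fixes U S :: "real mat"
  assumes U: "U \<in> carrier_mat p k" and S: "S \<in> carrier_mat p p" "S\<^sup>T = S"
  shows "U\<^sup>T * S * U \<in> carrier_mat k k" "(U\<^sup>T * S * U)\<^sup>T = U\<^sup>T * S * U"
proof -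
  have US: "U\<^sup>T * S \<in> carrier_mat k p" using U S by simp
  show "U\<^sup>T * S * U \<in> carrier_mat k k" using US U by simp
  have "(U\<^sup>T * S * U)\<^sup>T = U\<^sup>T * (U\<^sup>T * S)\<^sup>T" using US U by (rule transpose_mult)
  also have "(U\<^sup>T * S)\<^sup>T = S * U" using transpose_mult[of "U\<^sup>T" k p S p] U S by simp
  also have "U\<^sup>T * (S * U) = U\<^sup>T * S * U" using assoc_mult_mat[of "U\<^sup>T" k p S p U k] U S by simp
  finally show "(U\<^sup>T * S * U)\<^sup>T = U\<^sup>T * S * U" .
qed

section \<open>The exact bias of the variance estimator and its two bounds\<close>

theorem proposition5:
  fixes p n K :: nat
    and X A M \<Sigma> N E U1 U2 U3 :: "real mat"
    and \<theta> :: "real vec"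
    and \<Omega> :: "'w measure"
    and y :: "'w \<Rightarrow> real vec"
    and v :: "nat \<Rightarrow> real"
    and v_hat :: "nat \<Rightarrow> 'w \<Rightarrow> real"
  assumes "n < p"
    and "X \<in> carrier_mat p n" and "full_column_rank X"
    and "A \<in> carrier_mat n K" and "full_column_rank A"
    and "M \<in> carrier_mat p K"
    and "is_covariance_mat p \<Sigma>"
    and "\<theta> \<in> carrier_vec K" and "\<theta> \<noteq> 0\<^sub>v K"
    and "prob_space \<Omega>"
    and "square_integrable_random_vector \<Omega> p y"
    and "mean_vec \<Omega> p y = M *\<^sub>v \<theta>"
    and "var_mat \<Omega> p y = (l2_norm \<theta>)\<^sup>2 \<cdot>\<^sub>m \<Sigma>"
    and "\<And>k. k < K \<Longrightarrow> v k = var_mat \<Omega> K (\<lambda>\<omega>. theta_RTS X A (y \<omega>)) $$ (k, k)"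
    and "\<And>k \<omega>. k < K \<Longrightarrow> v_hat k \<omega> = SSE_RTS X A (y \<omega>) $$ (k, k)"
    and "N \<in> carrier_mat n (n - K)" and "onb_null_space N (A\<^sup>T)"
    and "E = X * N"
    and "U1 \<in> carrier_mat p (n - K)" and "left_singular_mat E U1"
    and "U2 \<in> carrier_mat p K" and "left_singular_mat (X * mat_inv (X\<^sup>T * X) * A) U2"
    and "U3 \<in> carrier_mat p (p - n)" and "left_singular_mat (1\<^sub>m p - proj_mat X) U3"
  shows "\<forall>k<K.
      prob_space.expectation \<Omega> (\<lambda>\<omega>. v k - v_hat k \<omega>) / (l2_norm \<theta>)\<^sup>2
        \<le> (col A k \<bullet> (mat_inv (X\<^sup>T * X) *\<^sub>v col A k))
            * (lambda_max (U2\<^sup>T * \<Sigma> * U2) - lambda_bar (U3\<^sup>T * \<Sigma> * U3))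
    \<and> prob_space.expectation \<Omega> (\<lambda>\<omega>. v k - v_hat k \<omega>) / (l2_norm \<theta>)\<^sup>2
        \<ge> (col A k \<bullet> (mat_inv (X\<^sup>T * X) *\<^sub>v col A k))
            * (lambda_min (U2\<^sup>T * \<Sigma> * U2) - lambda_bar (U3\<^sup>T * \<Sigma> * U3)
                - lambda_bar (U3\<^sup>T * M * M\<^sup>T * U3))"
proof (intro allI impI)
  fix k assume k: "k < K"
  interpret prob_space \<Omega> by fact
  note X = assms(2) and rkX = assms(3) and A = assms(4) and M = assms(6)
    and th = assms(8) and Y = assms(11) and U2 = assms(21) and U3 = assms(23)
  have S: "\<Sigma> \<in> carrier_mat p p" "\<Sigma>\<^sup>T = \<Sigma>" using assms(7) by (auto simp: is_covariance_mat_def)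
  define t where "t = (l2_norm \<theta>)\<^sup>2"
  have tt: "t = \<theta> \<bullet> \<theta>" by (simp add: t_def l2_norm_square)
  have t: "t > 0"
    using real_scalar_prod_self_eq_0[OF th] real_scalar_prod_self_ge_0[of \<theta>] assms(9) tt
    by fastforce
  define C where "C = mat_inv (X\<^sup>T * X)"
  note C = gram_inverse[OF X rkX, folded C_def]
  define a where "a = col A k"
  define g where "g = a \<bullet> (C *\<^sub>v a)"
  have a: "a \<in> carrier_vec n" unfolding a_def using A k by (intro col_carrier_vec)
  have Ca: "C *\<^sub>v a \<in> carrier_vec n" by (rule mult_mat_vec_carrier[OF C(1) a])
  define B where "B = X * C * A"
  have XC: "X * C \<in> carrier_mat p n" using X C(1) by simp
  have B: "B \<in> carrier_mat p K" using XC A by (simp add: B_def)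
  define b where "b = col B k"
  have b: "b \<in> carrier_vec p" unfolding b_def using B k by (intro col_carrier_vec)
  have bX: "b = X *\<^sub>v (C *\<^sub>v a)"
    unfolding b_def B_def a_def using col_mult2[OF XC A k] assoc_mult_mat_vec[OF X C(1) a]
    by (simp add: a_def)
  \<comment> \<open>This says X^T b = a, so that b . b = (C a) . (X^T b) = g.\<close>
  have XXCa: "X\<^sup>T *\<^sub>v (X *\<^sub>v (C *\<^sub>v a)) = a"
  proof -
    have G: "X\<^sup>T * X \<in> carrier_mat n n" using X by simp
    have "X\<^sup>T *\<^sub>v (X *\<^sub>v (C *\<^sub>v a)) = (X\<^sup>T * X) *\<^sub>v (C *\<^sub>v a)"
      using assoc_mult_mat_vec[of "X\<^sup>T" n p X n "C *\<^sub>v a"] X Ca by simp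
    also have "\<dots> = ((X\<^sup>T * X) * C) *\<^sub>v a" using assoc_mult_mat_vec[OF G C(1) a] by simp
    also have "\<dots> = a" using C(3) a by simp
    finally show ?thesis .
  qed
  have bb: "b \<bullet> b = g"
    using transpose_vec_mult_scalar[OF X Ca b] XXCa by (simp add: bX g_def)
  \<comment> \<open>The sign allows the estimates for the contribution of the mean to be multiplied
    by g.\<close>
  have g0: "g \<ge> 0" using bb real_scalar_prod_self_ge_0[of b] by simp

  \<comment> \<open>The coordinates of b in the orthonormal columns of U2. As U2 w = b, the vector w
    has the same squared length g, which gives the Rayleigh bounds their exact factor.\<close>
  define w where "w = U2\<^sup>T *\<^sub>v b"
  have w: "w \<in> carrier_vec K" using U2 b by (simp add: w_def)
  have UB: "U2\<^sup>T * B \<in> carrier_mat K K" using U2 B by simp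
  have U2w: "U2 *\<^sub>v w = b"
  proof -
    have "U2 *\<^sub>v w = col (U2 * (U2\<^sup>T * B)) k"
      using col_mult2[OF U2 UB k] col_mult2[of "U2\<^sup>T" K p B K k] U2 B k
      by (simp add: w_def b_def)
    also have "U2 * (U2\<^sup>T * B) = B"
      by (rule left_singular_mat_absorb[OF B U2]) (use assms(22) in \<open>simp add: B_def C_def\<close>)
    finally show ?thesis by (simp add: b_def)
  qed
  have ww: "w \<bullet> w = g"
    using transpose_vec_mult_scalar[OF U2 w b] U2w bb by (simp add: w_def[symmetric])
  note S2 = transpose_mult_symmetric[OF U2 S]
  have bSb: "b \<bullet> (\<Sigma> *\<^sub>v b) = w \<bullet> ((U2\<^sup>T * \<Sigma> * U2) *\<^sub>v w)"
    using transpose_mult_quad_form[OF U2 S(1) w] by (simp add: U2w)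
  have upper: "b \<bullet> (\<Sigma> *\<^sub>v b) \<le> g * lambda_max (U2\<^sup>T * \<Sigma> * U2)"
    using rayleigh_le_lambda_max[OF S2 w] by (simp add: bSb ww mult.commute)
  have lower: "g * lambda_min (U2\<^sup>T * \<Sigma> * U2) \<le> b \<bullet> (\<Sigma> *\<^sub>v b)"
    using lambda_min_le_rayleigh[OF S2 w] by (simp add: bSb ww mult.commute)

  have AC: "A\<^sup>T * C \<in> carrier_mat K n" using A C(1) by simp
  \<comment> \<open>The matrix of the estimator as a linear map of y. Symmetry of C makes it B^T, so
    its row k is b.\<close>
  define L where "L = A\<^sup>T * C * X\<^sup>T"
  have L: "L \<in> carrier_mat K p" using AC X by (simp add: L_def)
  have "B\<^sup>T = A\<^sup>T * (X * C)\<^sup>T" unfolding B_def using XC A by (rule transpose_mult)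
  also have "(X * C)\<^sup>T = C * X\<^sup>T" using transpose_mult[OF X C(1)] C(4) by simp
  also have "A\<^sup>T * (C * X\<^sup>T) = L"
    using assoc_mult_mat[of "A\<^sup>T" K n C n "X\<^sup>T" p] A C(1) X by (simp add: L_def)
  finally have rowL: "row L k = b" using B k by (simp add: b_def flip: row_transpose)
  have v: "v k = t * (b \<bullet> (\<Sigma> *\<^sub>v b))"
  proof -
    have "v k = var_mat \<Omega> K (\<lambda>\<omega>. L *\<^sub>v y \<omega>) $$ (k, k)"
      using assms(14)[OF k] by (simp add: theta_RTS_def L_def C_def)
    also have "\<dots> = b \<bullet> (var_mat \<Omega> p y *\<^sub>v b)"
      using var_mat_linear_diag[OF Y L k] by (simp add: rowL)
    also have "var_mat \<Omega> p y *\<^sub>v b = t \<cdot>\<^sub>v (\<Sigma> *\<^sub>v b)"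
      unfolding assms(13) t_def[symmetric] using S(1) b by (intro eq_vecI) auto
    also have "b \<bullet> (t \<cdot>\<^sub>v (\<Sigma> *\<^sub>v b)) = t * (b \<bullet> (\<Sigma> *\<^sub>v b))" using S(1) b by simp
    finally show ?thesis .
  qed

  define Q where "Q = 1\<^sub>m p - proj_mat X"
  have QU: "Q = U3 * U3\<^sup>T"
    using left_singular_mat_complement[OF X rkX _ U3 assms(24)] assms(1) by (simp add: Q_def)
  have Q: "Q \<in> carrier_mat p p" using U3 by (simp add: QU)
  \<comment> \<open>\<open>SSE_RTS\<close> divides by a difference of reals,
    \<open>lambda_bar\<close> by a dimension that is a natural difference; n < p identifies the
    two.\<close>
  define q where "q = real (p - n)"
  have q: "q > 0" using assms(1) by (simp add: q_def)
  have gk: "(A\<^sup>T * C * A) $$ (k, k) = g"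
  proof -
    have "(A\<^sup>T * C * A) $$ (k, k) = (A\<^sup>T * (C * A)) $$ (k, k)"
      using assoc_mult_mat[of "A\<^sup>T" K n C n A K] A C(1) by simp
    also have "\<dots> = row A\<^sup>T k \<bullet> col (C * A) k" using A C(1) k by (intro index_mult_mat(1)) auto
    also have "\<dots> = g" using A k col_mult2[OF C(1) A k] by (simp add: g_def a_def)
    finally show ?thesis .
  qed
  have vh: "v_hat k \<omega> = g / q * (y \<omega> \<bullet> (Q *\<^sub>v y \<omega>))" for \<omega>
  proof -
    have "A\<^sup>T * C * A \<in> carrier_mat K K" using AC A by simp
    then have "(c \<cdot>\<^sub>m (A\<^sup>T * C * A)) $$ (k, k) = c * (A\<^sup>T * C * A) $$ (k, k)" for c
      using k by (intro index_smult_mat(1)) auto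
    moreover have "real p - real n = q" using assms(1) by (simp add: q_def of_nat_diff)
    ultimately have "v_hat k \<omega> = (y \<omega> \<bullet> (Q *\<^sub>v y \<omega>) / q) * (A\<^sup>T * C * A) $$ (k, k)"
      using assms(15)[OF k] carrier_matD[OF X] by (simp only: SSE_RTS_def Q_def C_def)
    then show ?thesis by (simp add: gk)
  qed
  define m where "m = M *\<^sub>v \<theta>"
  have m: "m \<in> carrier_vec p" using M th by (simp add: m_def)
  have "expectation (\<lambda>\<omega>. v k - v_hat k \<omega>)
      = v k - g / q * (mat_trace (Q * var_mat \<Omega> p y) + m \<bullet> (Q *\<^sub>v m))"
    unfolding vh using expectation_quad_form[OF Y Q]
    by (simp add: prob_space assms(12) m_def)
  also have "mat_trace (Q * var_mat \<Omega> p y) = t * mat_trace (Q * \<Sigma>)"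
    using mult_smult_distrib[OF Q S(1)] Q S(1)
    by (simp add: assms(13) t_def mat_trace_def sum_distrib_left)
  \<comment> \<open>Cyclicity of the trace leaves a square matrix of size p - n; its factor q
    cancels the divisor in \<open>v_hat\<close>.\<close>
  also have "mat_trace (Q * \<Sigma>) = q * lambda_bar (U3\<^sup>T * \<Sigma> * U3)"
  proof -
    have US: "U3\<^sup>T * \<Sigma> \<in> carrier_mat (p - n) p" using U3 S by simp
    have "Q * \<Sigma> = U3 * (U3\<^sup>T * \<Sigma>)"
      using assoc_mult_mat[of U3 p "p - n" "U3\<^sup>T" p \<Sigma> p] U3 S by (simp add: QU)
    then have "mat_trace (Q * \<Sigma>) = mat_trace (U3\<^sup>T * \<Sigma> * U3)"
      using mat_trace_mult_commute[OF U3 US] by simp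
    then show ?thesis using q US U3 by (simp add: lambda_bar_def q_def)
  qed
  \<comment> \<open>An exact formula whose last term is the contribution of the mean. The upper
    bound drops that term, the lower bound estimates it.\<close>
  finally have main: "expectation (\<lambda>\<omega>. v k - v_hat k \<omega>) / t
      = b \<bullet> (\<Sigma> *\<^sub>v b) - g * lambda_bar (U3\<^sup>T * \<Sigma> * U3) - g * ((m \<bullet> (Q *\<^sub>v m)) / (q * t))"
    using t q by (simp add: v field_simps)

  define W where "W = U3\<^sup>T * M"
  have W: "W \<in> carrier_mat (p - n) K" using U3 M by (simp add: W_def)
  have mQm: "m \<bullet> (Q *\<^sub>v m) = (W *\<^sub>v \<theta>) \<bullet> (W *\<^sub>v \<theta>)"
  proof -
    have z: "U3\<^sup>T *\<^sub>v m \<in> carrier_vec (p - n)" using U3 m by simp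
    have "Q *\<^sub>v m = U3 *\<^sub>v (U3\<^sup>T *\<^sub>v m)"
      using assoc_mult_mat_vec[of U3 p "p - n" "U3\<^sup>T" p m] U3 m by (simp add: QU)
    then have "m \<bullet> (Q *\<^sub>v m) = (U3\<^sup>T *\<^sub>v m) \<bullet> (U3\<^sup>T *\<^sub>v m)"
      using transpose_vec_mult_scalar[OF U3 z m] by simp
    also have "U3\<^sup>T *\<^sub>v m = W *\<^sub>v \<theta>"
      using assoc_mult_mat_vec[of "U3\<^sup>T" "p - n" p M K \<theta>] U3 M th by (simp add: W_def m_def)
    finally show ?thesis .
  qed
  have mQm0: "0 \<le> g * ((m \<bullet> (Q *\<^sub>v m)) / (q * t))"
    using g0 q t by (simp add: mQm real_scalar_prod_self_ge_0)
  have WW: "U3\<^sup>T * M * M\<^sup>T * U3 = W * W\<^sup>T"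
  proof -
    have "W\<^sup>T = M\<^sup>T * U3" using transpose_mult[of "U3\<^sup>T" "p - n" p M K] U3 M by (simp add: W_def)
    then show ?thesis
      using assoc_mult_mat[OF W, of "M\<^sup>T" p U3 "p - n"] U3 M by (simp add: W_def)
  qed
  \<comment> \<open>The factor t is the squared length of \<theta>, so it cancels the scaling of the
    bias, while q turns the trace into an average.\<close>
  have "m \<bullet> (Q *\<^sub>v m) \<le> mat_trace (W * W\<^sup>T) * t"
    unfolding mQm tt by (rule mult_mat_vec_frobenius_bound[OF W th])
  then have "(m \<bullet> (Q *\<^sub>v m)) / (q * t) \<le> lambda_bar (W * W\<^sup>T)"
  proof -
    assume le: "m \<bullet> (Q *\<^sub>v m) \<le> mat_trace (W * W\<^sup>T) * t"
    have "lambda_bar (W * W\<^sup>T) = mat_trace (W * W\<^sup>T) / q"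
      using W by (simp add: lambda_bar_def q_def)
    then show ?thesis using q t le by (simp add: divide_le_eq mult.assoc)
  qed
  then have mQm1: "g * ((m \<bullet> (Q *\<^sub>v m)) / (q * t)) \<le> g * lambda_bar (U3\<^sup>T * M * M\<^sup>T * U3)"
    unfolding WW using g0 by (rule mult_left_mono)

  show "expectation (\<lambda>\<omega>. v k - v_hat k \<omega>) / (l2_norm \<theta>)\<^sup>2
        \<le> (col A k \<bullet> (mat_inv (X\<^sup>T * X) *\<^sub>v col A k))
            * (lambda_max (U2\<^sup>T * \<Sigma> * U2) - lambda_bar (U3\<^sup>T * \<Sigma> * U3))
    \<and> expectation (\<lambda>\<omega>. v k - v_hat k \<omega>) / (l2_norm \<theta>)\<^sup>2
        \<ge> (col A k \<bullet> (mat_inv (X\<^sup>T * X) *\<^sub>v col A k))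
            * (lambda_min (U2\<^sup>T * \<Sigma> * U2) - lambda_bar (U3\<^sup>T * \<Sigma> * U3)
                - lambda_bar (U3\<^sup>T * M * M\<^sup>T * U3))"
    \<comment> \<open>Once g is distributed, its products with the eigenvalues are atoms and the
      remaining inequalities are linear.\<close>
    unfolding t_def[symmetric] C_def[symmetric] a_def[symmetric] g_def[symmetric] main
      right_diff_distrib
    using upper lower mQm0 mQm1 by linarith
qed

end
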